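(* If $p$ is a nonzero polynomial with nonnegative real coefficients, then $$R(p):=\frac{H(p^2)\,(\deg(p)+1)}{p(1)^2} > 0.631 .$$
   Context: For a polynomial $q(x)=\sum_{i=0}^{\deg(q)} q_i x^i$ with real coefficients, the height of $q$ is $H(q):=\max\{|q_i|\colon 0\le i\le \deg(q)\}$. *)

theory Defs
  imports Complex_Main "HOL-Computational_Algebra.Polynomial"
begin

definition height :: "real poly \<Rightarrow> real" where
  "height q = Max ((\<lambda>i. \<bar>coeff q i\<bar>) ` {0..degree q})"

definition R_ratio :: "real poly \<Rightarrow> real" where
  "R_ratio p = height (p ^ 2) * (real (degree p) + 1) / (poly p 1) ^ 2"

end

(* A kernel argument in the spirit of Martin-O'Bryant and Matolcsi-Vinuesa, made finite. Let f be a
   nonnegative function on N = a k consecutive integers with sum 1, let c and r be its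
   autoconvolution (centred) and autocorrelation, and let K be the autocorrelation of a step
   function eta with b steps of length k. If q is f plus its reflection and F = q * eta, then
     sum c K + sum r K = (sum F^2) / 2.
   From above: c <= h gives sum c K <= h sum K, while c and r have the same sum of squares
   ("energy"), which is at most h, so Cauchy-Schwarz bounds the deviation of sum r K from its mean.
   From below: F lives on only (a + b) k points, and sum F^2 >= 2 s sum psi F - s^2 sum psi^2 for
   every step function psi; sum psi F is at least 2 k times the minimum of the correlations of eta
   and psi at the lags 0..a. Replacing p(x) by p(x^r) (1 + x + ... + x^(r-1)) does not change R(p),
   so a, b may be fixed and k taken large. A good choice of eta and psi gives 2 R(p) > 1.2637. *)

theory Submission
  imports Defs "HOL-Analysis.Convex"
begin

section \<open>Step functions on blocks of length \<open>k\<close> and their correlations\<close>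

lemma sum_int_blocks:
  fixes g :: "int \<Rightarrow> real" and k :: nat
  assumes "k > 0"
  shows "(\<Sum>z\<in>{lo * int k..<hi * int k}. g z) =
    (\<Sum>l\<in>{lo..<hi}. \<Sum>v\<in>{0..<int k}. g (l * int k + v))"
proof -
  have 1: "lo \<le> z div int k \<and> z div int k < hi" if "z \<in> {lo * int k..<hi * int k}" for z
  proof
    show "lo \<le> z div int k"
      using that assms zdiv_mono1[of "lo * int k" z "int k"] by auto
    show "z div int k < hi"
    proof (rule ccontr)
      assume "\<not> z div int k < hi"
      then have "hi * int k \<le> z div int k * int k"
        by (intro mult_right_mono) auto
      also have "\<dots> \<le> z"
        using assms pos_mod_sign[of "int k" z] div_mult_mod_eq[of z "int k"] by linarith
      finally show False using that by simp
    qed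
  qed
  have 2: "l * int k + v < hi * int k" if "l < hi" "v < int k" for l v
  proof -
    have "(l + 1) * int k \<le> hi * int k"
      using that by (intro mult_right_mono) auto
    then show ?thesis using that by (simp add: algebra_simps)
  qed
  have 3: "lo * int k \<le> l * int k + v" if "lo \<le> l" "0 \<le> v" for l v
    using that mult_right_mono[of lo l "int k"] by simp
  show ?thesis
    unfolding sum.cartesian_product
    by (rule sum.reindex_bij_witness[where i = "\<lambda>(l, v). l * int k + v"
          and j = "\<lambda>z. (z div int k, z mod int k)"])
       (use assms 1 2 3 in \<open>auto simp: div_add1_eq\<close>)
qed

text \<open>A window of \<open>k\<close> consecutive integers that starts at offset \<open>r\<close>
  of block \<open>j\<close> meets only the blocks \<open>j\<close> and \<open>j + 1\<close>, in
  \<open>k - r\<close> and \<open>r\<close> points.\<close>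

lemma sum_window:
  fixes s :: "int \<Rightarrow> real" and k :: nat
  assumes "0 \<le> r" "r < int k"
  shows "(\<Sum>v\<in>{0..<int k}. s ((j * int k + r + v) div int k)) =
    of_int (int k - r) * s j + of_int r * s (j + 1)"
proof -
  have "(\<Sum>v\<in>{0..<int k}. s ((j * int k + r + v) div int k)) =
    (\<Sum>v\<in>{0..<int k - r}. s ((j * int k + r + v) div int k)) +
    (\<Sum>v\<in>{int k - r..<int k}. s ((j * int k + r + v) div int k))"
    using assms by (subst sum.union_disjoint[symmetric]) (auto simp: ivl_disj_un)
  also have "(\<Sum>v\<in>{0..<int k - r}. s ((j * int k + r + v) div int k)) = (\<Sum>v\<in>{0..<int k - r}. s j)"
  proof (rule sum.cong)
    fix v assume "v \<in> {0..<int k - r}"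
    then have "(j * int k + r + v) div int k = j"
      using assms by (intro int_div_pos_eq[where r = "r + v"]) auto
    then show "s ((j * int k + r + v) div int k) = s j" by simp
  qed simp
  also have "(\<Sum>v\<in>{int k - r..<int k}. s ((j * int k + r + v) div int k)) =
    (\<Sum>v\<in>{int k - r..<int k}. s (j + 1))"
  proof (rule sum.cong)
    fix v assume "v \<in> {int k - r..<int k}"
    then have "(j * int k + r + v) div int k = j + 1"
      using assms by (intro int_div_pos_eq[where r = "r + v - int k"]) (auto simp: algebra_simps)
    then show "s ((j * int k + r + v) div int k) = s (j + 1)" by simp
  qed simp
  finally show ?thesis using assms by simp
qed

text \<open>Only \<open>\<eta>\<close> is read in blocks; \<open>\<phi>\<close> stays a function of
  single integers, so that it can be a stretched step function or the convolution \<open>F\<close>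
  used later.\<close>

definition step_corr :: "nat \<Rightarrow> nat \<Rightarrow> (int \<Rightarrow> real) \<Rightarrow> (int \<Rightarrow> real) \<Rightarrow> int \<Rightarrow> real" where
  "step_corr k b \<eta> \<phi> i = (\<Sum>z\<in>{0..<int b * int k}. \<eta> (z div int k) * \<phi> (z + i))"

definition corr :: "nat \<Rightarrow> (int \<Rightarrow> real) \<Rightarrow> (int \<Rightarrow> real) \<Rightarrow> int \<Rightarrow> real" where
  "corr b \<eta> \<psi> j = (\<Sum>l\<in>{0..<int b}. \<eta> l * \<psi> (l + j))"

text \<open>Every block of \<open>\<eta>\<close> sees one window of \<open>\<psi>\<close>. So the
  correlation of two step functions is \<open>k\<close> times the linear interpolation of the block
  correlations.\<close>

lemma step_corr_step:
  assumes "0 \<le> r" "r < int k"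
  shows "step_corr k b \<eta> (\<lambda>z. \<psi> (z div int k)) (j * int k + r) =
    of_int (int k - r) * corr b \<eta> \<psi> j + of_int r * corr b \<eta> \<psi> (j + 1)"
proof -
  have "step_corr k b \<eta> (\<lambda>z. \<psi> (z div int k)) (j * int k + r) =
    (\<Sum>l\<in>{0..<int b}. \<Sum>v\<in>{0..<int k}. \<eta> ((l * int k + v) div int k) *
       \<psi> ((l * int k + v + (j * int k + r)) div int k))"
    using assms sum_int_blocks[where lo = 0 and hi = "int b" and k = k]
    by (simp add: step_corr_def)
  also have "\<dots> = (\<Sum>l\<in>{0..<int b}. \<Sum>v\<in>{0..<int k}. \<eta> l * \<psi> (((l + j) * int k + r + v) div int k))"
    using assms by (intro sum.cong refl) (simp add: algebra_simps)
  also have "\<dots> = (\<Sum>l\<in>{0..<int b}. \<eta> l *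
      (of_int (int k - r) * \<psi> (l + j) + of_int r * \<psi> (l + j + 1)))"
    by (simp only: sum_distrib_left[symmetric] sum_window[OF assms])
  finally show ?thesis
    by (simp add: corr_def sum_distrib_left sum.distrib sum_subtractf algebra_simps)
qed

section \<open>Quadratic forms, additive energy and symmetries of the kernel\<close>

text \<open>Expand \<open>q i * q j\<close> into four products. Reflecting both factors only changes
  the sign of the difference, harmless for even \<open>K\<close>; reflecting one factor turns the
  difference into a centred sum. This puts autocorrelation and autoconvolution into one quadratic
  form.\<close>

lemma sum_add_sum_rev_product:
  fixes f :: "nat \<Rightarrow> real" and K :: "int \<Rightarrow> real" and N :: nat
  assumes even: "\<And>d. K (- d) = K d"
  defines "q \<equiv> \<lambda>i. f i + f (N - Suc i)"
  shows "(\<Sum>i<N. \<Sum>j<N. q i * q j * K (int i - int j)) =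
    2 * (\<Sum>i<N. \<Sum>j<N. f i * f j * K (int i - int j)) +
    2 * (\<Sum>i<N. \<Sum>j<N. f i * f j * K (int i + int j - (int N - 1)))"
proof -
  have rev: "(\<Sum>i<N. g (N - Suc i)) = (\<Sum>i<N. g i)" for g :: "nat \<Rightarrow> real"
    by (rule sum.nat_diff_reindex)
  have K1: "(\<Sum>j<N. f (N - Suc j) * K (x - int j)) = (\<Sum>j<N. f j * K (x + int j - (int N - 1)))" for x
    by (subst rev[symmetric]) (auto intro!: sum.cong simp: of_nat_diff algebra_simps)
  have K2: "(\<Sum>i<N. f (N - Suc i) * K (int i - y)) = (\<Sum>i<N. f i * K (int i + y - (int N - 1)))" for y
  proof -
    have "K (int i - y) = K (int (N - Suc i) + y - (int N - 1))" if "i < N" for i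
    proof -
      have "int (N - Suc i) + y - (int N - 1) = - (int i - y)"
        using that by (simp add: of_nat_diff)
      then show ?thesis by (simp only: even)
    qed
    then show ?thesis
      by (subst rev[of "\<lambda>i. f i * K (int i + y - (int N - 1))", symmetric]) simp
  qed
  have "(\<Sum>i<N. \<Sum>j<N. f (N - Suc i) * f (N - Suc j) * K (int i - int j)) =
    (\<Sum>i<N. f (N - Suc i) * (\<Sum>j<N. f (N - Suc j) * K (int i - int j)))"
    by (simp add: sum_distrib_left mult.assoc)
  also have "\<dots> = (\<Sum>i<N. \<Sum>j<N. f (N - Suc i) * f j * K (int i + int j - (int N - 1)))"
    by (simp add: sum_distrib_left mult.assoc K1)
  also have "\<dots> = (\<Sum>i<N. \<Sum>j<N. f i * f j * K (int j - int i))"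
    by (subst rev[symmetric], intro sum.cong refl) (auto simp: of_nat_diff Suc_diff_Suc)
  also have "\<dots> = (\<Sum>i<N. \<Sum>j<N. f i * f j * K (int i - int j))"
    by (intro sum.cong refl) (metis even minus_diff_eq)
  finally have 1: "(\<Sum>i<N. \<Sum>j<N. f (N - Suc i) * f (N - Suc j) * K (int i - int j)) =
    (\<Sum>i<N. \<Sum>j<N. f i * f j * K (int i - int j))" .
  have 2: "(\<Sum>i<N. \<Sum>j<N. f i * f (N - Suc j) * K (int i - int j)) =
    (\<Sum>i<N. \<Sum>j<N. f i * f j * K (int i + int j - (int N - 1)))"
    by (simp add: mult.assoc sum_distrib_left[symmetric] K1)
  have 3: "(\<Sum>i<N. \<Sum>j<N. f (N - Suc i) * f j * K (int i - int j)) =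
    (\<Sum>i<N. \<Sum>j<N. f i * f j * K (int i + int j - (int N - 1)))"
    by (subst (1 2) sum.swap)
      (simp add: mult.left_commute[of "f _" "f _" "K _"] mult.assoc sum_distrib_left[symmetric] K2)
  show ?thesis
    unfolding q_def using 1 2 3 by (simp add: algebra_simps sum.distrib)
qed

lemma sum_fibre_square:
  fixes w :: "'a \<Rightarrow> real"
  assumes "finite S" "finite D" "g ` S \<subseteq> D"
  shows "(\<Sum>e\<in>D. (\<Sum>x\<in>{x\<in>S. g x = e}. w x)\<^sup>2) =
    (\<Sum>x\<in>S. \<Sum>y\<in>S. if g x = g y then w x * w y else 0)"
proof -
  have "(\<Sum>x\<in>S. \<Sum>y\<in>S. if g x = g y then w x * w y else 0) =
    (\<Sum>x\<in>S. w x * (\<Sum>y\<in>{y\<in>S. g y = g x}. w y))"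
    using assms by (auto simp: sum_distrib_left sum.If_cases Int_def eq_commute intro!: sum.cong)
  also have "\<dots> = (\<Sum>e\<in>D. \<Sum>x\<in>{x\<in>S. g x = e}. w x * (\<Sum>y\<in>{y\<in>S. g y = g x}. w y))"
    by (rule sum.group[OF assms, symmetric])
  also have "\<dots> = (\<Sum>e\<in>D. (\<Sum>x\<in>{x\<in>S. g x = e}. w x)\<^sup>2)"
    by (intro sum.cong refl) (simp add: power2_eq_square sum_distrib_right)
  finally show ?thesis by simp
qed

text \<open>Additive energy: \<open>i + j = k + l\<close> holds exactly when
  \<open>i - k = l - j\<close>, and regrouping the four indices keeps the product of their
  weights.\<close>

lemma autoconv_autocorr_energy:
  fixes f :: "nat \<Rightarrow> real"
  defines "w \<equiv> \<lambda>(i, j). f i * f j"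
  shows "(\<Sum>x\<in>{..<N} \<times> {..<N}. \<Sum>y\<in>{..<N} \<times> {..<N}.
      if int (fst x) + int (snd x) - c = int (fst y) + int (snd y) - c then w x * w y else 0) =
    (\<Sum>x\<in>{..<N} \<times> {..<N}. \<Sum>y\<in>{..<N} \<times> {..<N}.
      if int (fst x) - int (snd x) = int (fst y) - int (snd y) then w x * w y else 0)"
  unfolding sum.cartesian_product w_def
  by (rule sum.reindex_bij_witness[where i = "\<lambda>((i, j), (k, l)). ((i, l), (j, k))"
        and j = "\<lambda>((i, j), (k, l)). ((i, k), (l, j))"])
     (auto simp: algebra_simps)

lemma div_notin_blocks:
  assumes "k > 0" "z \<notin> {0..<int b * int k}"
  shows "z div int k \<notin> {0..<int b}"
  using assms zdiv_mono1[of "int b * int k" z "int k"]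
  by (auto simp: pos_imp_zdiv_nonneg_iff)

text \<open>Once the sum is cut to the points where \<open>z\<close> and \<open>z + d\<close> both
  lie in the blocks, a shift by \<open>d\<close> exchanges the two factors.\<close>

lemma step_corr_minus:
  assumes k: "k > 0" and supp: "\<And>l. l \<notin> {0..<int b} \<Longrightarrow> \<eta> l = 0"
  shows "step_corr k b \<eta> (\<lambda>z. \<eta> (z div int k)) (- d) = step_corr k b \<eta> (\<lambda>z. \<eta> (z div int k)) d"
proof -
  have z: "\<eta> (z div int k) = 0" if "z \<notin> {0..<int b * int k}" for z
    using that k by (intro supp div_notin_blocks)
  have r: "step_corr k b \<eta> (\<lambda>z. \<eta> (z div int k)) d =
    (\<Sum>z\<in>{z\<in>{0..<int b * int k}. z + d \<in> {0..<int b * int k}}. \<eta> (z div int k) * \<eta> ((z + d) div int k))" for d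
    unfolding step_corr_def using z by (intro sum.mono_neutral_right) auto
  show ?thesis
    unfolding r
    by (rule sum.reindex_bij_witness[where i = "\<lambda>z. z + d" and j = "\<lambda>z. z - d"]) auto
qed

text \<open>Convolution with a step function is adjoint to correlation with it. The
  \<open>a + b\<close> blocks contain the support of every translate of \<open>\<eta>\<close> by
  some \<open>i < a * k\<close>, so nothing is cut off.\<close>

lemma sum_mult_conv_step:
  fixes q :: "nat \<Rightarrow> real"
  assumes k: "k > 0" and supp: "\<And>l. l \<notin> {0..<int b} \<Longrightarrow> \<eta> l = 0"
  shows "(\<Sum>y\<in>{0..<int (a + b) * int k}. \<phi> y * (\<Sum>i<a * k. q i * \<eta> ((y - int i) div int k))) =
    (\<Sum>i<a * k. q i * step_corr k b \<eta> \<phi> (int i))"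
proof -
  have z: "\<eta> (z div int k) = 0" if "z \<notin> {0..<int b * int k}" for z
    using that k by (intro supp div_notin_blocks)
  have "(\<Sum>y\<in>{0..<int (a + b) * int k}. \<phi> y * \<eta> ((y - int i) div int k)) = step_corr k b \<eta> \<phi> (int i)"
    if "i < a * k" for i
  proof -
    have "int i < int a * int k"
      using that by (metis of_nat_less_iff of_nat_mult)
    then have "(\<Sum>y\<in>{0..<int (a + b) * int k}. \<phi> y * \<eta> ((y - int i) div int k)) =
      (\<Sum>y\<in>{int i..<int i + int b * int k}. \<phi> y * \<eta> ((y - int i) div int k))"
      by (intro sum.mono_neutral_right) (auto simp: algebra_simps intro!: z)
    also have "\<dots> = step_corr k b \<eta> \<phi> (int i)"
      unfolding step_corr_def
      by (rule sum.reindex_bij_witness[where i = "\<lambda>z. z + int i" and j = "\<lambda>z. z - int i"]) auto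
    finally show ?thesis .
  qed
  then have "(\<Sum>i<a * k. q i * step_corr k b \<eta> \<phi> (int i)) =
    (\<Sum>i<a * k. \<Sum>y\<in>{0..<int (a + b) * int k}. q i * (\<phi> y * \<eta> ((y - int i) div int k)))"
    by (simp add: sum_distrib_left[symmetric])
  also have "\<dots> = (\<Sum>y\<in>{0..<int (a + b) * int k}. \<phi> y * (\<Sum>i<a * k. q i * \<eta> ((y - int i) div int k)))"
    by (subst sum.swap) (simp add: sum_distrib_left mult.left_commute)
  finally show ?thesis by simp
qed

section \<open>Centred Cauchy-Schwarz and sums over one interpolated block\<close>

text \<open>Cauchy-Schwarz for the deviations from the means. Centring later yields the factor
  \<open>h - 1 / (2 * N)\<close> in place of \<open>h\<close>.\<close>

lemma Cauchy_Schwarz_centered: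
  fixes r K :: "'a \<Rightarrow> real"
  assumes "finite D" "D \<noteq> {}"
  shows "((\<Sum>x\<in>D. r x * K x) - (\<Sum>x\<in>D. r x) * (\<Sum>x\<in>D. K x) / card D)\<^sup>2 \<le>
    ((\<Sum>x\<in>D. (r x)\<^sup>2) - (\<Sum>x\<in>D. r x)\<^sup>2 / card D) * ((\<Sum>x\<in>D. (K x)\<^sup>2) - (\<Sum>x\<in>D. K x)\<^sup>2 / card D)"
proof -
  have n: "real (card D) > 0"
    using assms by (simp add: card_gt_0_iff)
  have cov: "(\<Sum>x\<in>D. (u x - (\<Sum>x\<in>D. u x) / card D) * (v x - (\<Sum>x\<in>D. v x) / card D)) =
    (\<Sum>x\<in>D. u x * v x) - (\<Sum>x\<in>D. u x) * (\<Sum>x\<in>D. v x) / card D" for u v :: "'a \<Rightarrow> real"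
    using n by (simp add: algebra_simps sum.distrib sum_subtractf sum_distrib_left[symmetric]
        sum_distrib_right[symmetric] sum_divide_distrib[symmetric] power2_eq_square)
  show ?thesis
    using Cauchy_Schwarz_ineq_sum[of "\<lambda>x. r x - (\<Sum>x\<in>D. r x) / card D" "\<lambda>x. K x - (\<Sum>x\<in>D. K x) / card D" D]
    by (simp only: cov power2_eq_square)
qed

lemma sum_int_lessThan: "(\<Sum>r\<in>{0..<int k}. real_of_int r) = real k * (real k - 1) / 2"
proof (induction k)
  case (Suc k)
  have "{0..<int (Suc k)} = insert (int k) {0..<int k}" by auto
  then show ?case using Suc by (simp add: field_simps)
qed simp

lemma sum_int_lessThan_squares:
  "(\<Sum>r\<in>{0..<int k}. (real_of_int r)\<^sup>2) = real k * (real k - 1) * (2 * real k - 1) / 6"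
proof (induction k)
  case (Suc k)
  have "{0..<int (Suc k)} = insert (int k) {0..<int k}" by auto
  then show ?case using Suc by (simp add: field_simps power2_eq_square)
qed simp

text \<open>The quadratic term is the trapezoid area. The linear term is a difference of end values,
  which telescopes over consecutive blocks.\<close>

lemma sum_interpolation:
  "(\<Sum>r\<in>{0..<int k}. of_int (int k - r) * x + of_int r * y) =
    (real k)\<^sup>2 * ((x + y) / 2) + real k * ((x - y) / 2)"
proof -
  have "(\<Sum>r\<in>{0..<int k}. of_int (int k - r) * x + of_int r * y) =
    (\<Sum>r\<in>{0..<int k}. real k * x + of_int r * (y - x))"
    by (simp add: algebra_simps)
  also have "\<dots> = real k * (real k * x) + (\<Sum>r\<in>{0..<int k}. of_int r) * (y - x)"
    by (simp add: sum.distrib sum_distrib_right)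
  also have "\<dots> = (real k)\<^sup>2 * ((x + y) / 2) + real k * ((x - y) / 2)"
    unfolding sum_int_lessThan by (simp add: field_simps power2_eq_square)
  finally show ?thesis .
qed

lemma sum_interpolation_squares:
  "(\<Sum>r\<in>{0..<int k}. (of_int (int k - r) * x + of_int r * y)\<^sup>2) =
    real k ^ 3 * ((x\<^sup>2 + x * y + y\<^sup>2) / 3) + (real k)\<^sup>2 * ((x\<^sup>2 - y\<^sup>2) / 2) + real k * ((x - y)\<^sup>2 / 6)"
proof -
  have "(\<Sum>r\<in>{0..<int k}. (of_int (int k - r) * x + of_int r * y)\<^sup>2) =
    (\<Sum>r\<in>{0..<int k}. (real k * x)\<^sup>2 + of_int r * (2 * real k * x * (y - x)) + (of_int r)\<^sup>2 * (y - x)\<^sup>2)"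
    by (simp add: algebra_simps power2_eq_square)
  also have "\<dots> = real k * (real k * x)\<^sup>2 + (\<Sum>r\<in>{0..<int k}. of_int r) * (2 * real k * x * (y - x))
      + (\<Sum>r\<in>{0..<int k}. (of_int r)\<^sup>2) * (y - x)\<^sup>2"
    by (simp add: sum.distrib sum_distrib_right)
  also have "\<dots> = real k ^ 3 * ((x\<^sup>2 + x * y + y\<^sup>2) / 3) + (real k)\<^sup>2 * ((x\<^sup>2 - y\<^sup>2) / 2) + real k * ((x - y)\<^sup>2 / 6)"
    unfolding sum_int_lessThan sum_int_lessThan_squares
    by (simp add: field_simps power2_eq_square power3_eq_cube)
  finally show ?thesis .
qed

section \<open>The kernel inequality for general step functions\<close>

text \<open>\<open>X\<close> is the sum of \<open>r d * K d\<close>, bounded from below by the first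
  inequality and kept near its mean value by the second. The centred sums and the differences lie
  strictly between \<open>- N\<close> and \<open>N\<close>; \<open>D\<close> adds the point
  \<open>- N\<close> and so has exactly \<open>2 * N\<close> elements.\<close>

lemma autoconv_ineq:
  fixes f :: "nat \<Rightarrow> real" and \<eta> \<psi> :: "int \<Rightarrow> real" and a b k N :: nat
  defines "N \<equiv> a * k"
  defines "D \<equiv> {- int N..<int N}"
  defines "K \<equiv> step_corr k b \<eta> (\<lambda>z. \<eta> (z div int k))"
  assumes k: "k > 0" and a: "a > 0"
    and supp: "\<And>l. l \<notin> {0..<int b} \<Longrightarrow> \<eta> l = 0" and \<eta>: "\<And>l. \<eta> l \<ge> 0"
    and f: "\<And>i. f i \<ge> 0" and f1: "(\<Sum>i<N. f i) = 1"
    and h: "\<And>e. (\<Sum>(i, j)\<in>{x\<in>{..<N} \<times> {..<N}. int (fst x) + int (snd x) - (int N - 1) = e}. f i * f j) \<le> h"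
    and \<gamma>: "\<And>j. j \<in> {0..int a} \<Longrightarrow> \<gamma> \<le> corr b \<eta> \<psi> j" and s: "s \<ge> 0"
  obtains X where
    "2 * s * \<gamma> * real k - s\<^sup>2 * real k * (\<Sum>j\<in>{0..<int (a + b)}. (\<psi> j)\<^sup>2) / 2 \<le> h * (\<Sum>d\<in>D. K d) + X"
    "(X - (\<Sum>d\<in>D. K d) / real (2 * N))\<^sup>2 \<le>
      (h - 1 / real (2 * N)) * ((\<Sum>d\<in>D. (K d)\<^sup>2) - (\<Sum>d\<in>D. K d)\<^sup>2 / real (2 * N))"
proof -
  define S where "S = {..<N} \<times> {..<N}"
  define w where "w = (\<lambda>x::nat \<times> nat. f (fst x) * f (snd x))"
  define gc where "gc = (\<lambda>x::nat \<times> nat. int (fst x) + int (snd x) - (int N - 1))"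
  define gr where "gr = (\<lambda>x::nat \<times> nat. int (fst x) - int (snd x))"
  define c where "c = (\<lambda>e. \<Sum>x\<in>{x\<in>S. gc x = e}. w x)"
  define r where "r = (\<lambda>e. \<Sum>x\<in>{x\<in>S. gr x = e}. w x)"
  define q where "q = (\<lambda>i. f i + f (N - Suc i))"
  define Y where "Y = {0..<int (a + b) * int k}"
  define F where "F = (\<lambda>y. \<Sum>i<N. q i * \<eta> ((y - int i) div int k))"
  define X where "X = (\<Sum>d\<in>D. r d * K d)"
  define P where "P = (\<Sum>j\<in>{0..<int (a + b)}. (\<psi> j)\<^sup>2)"
  have N: "N > 0" using k a by (simp add: N_def)
  have fin: "finite S" "finite D" by (simp_all add: S_def D_def)
  have im: "gc ` S \<subseteq> D" "gr ` S \<subseteq> D"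
    by (auto simp: gc_def gr_def S_def D_def)
  have cardD: "card D = 2 * N" by (simp add: D_def)
  have K0: "K d \<ge> 0" for d
    unfolding K_def step_corr_def by (intro sum_nonneg mult_nonneg_nonneg \<eta>)
  have c0: "c e \<ge> 0" for e
    unfolding c_def w_def by (intro sum_nonneg mult_nonneg_nonneg f)
  have ch: "c e \<le> h" for e
    using h[of e] by (simp add: c_def S_def gc_def w_def case_prod_unfold)
  have wK: "(\<Sum>d\<in>D. (\<Sum>x\<in>{x\<in>S. g x = d}. w x) * G d) = (\<Sum>x\<in>S. w x * G (g x))"
    if "g ` S \<subseteq> D" for g and G :: "int \<Rightarrow> real"
    using sum.group[OF fin that, of "\<lambda>x. w x * G (g x)"]
    by (simp add: sum_distrib_right)
  have w1: "(\<Sum>x\<in>S. w x) = 1"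
    using sum_product[of f "{..<N}" f "{..<N}"] f1
    by (simp add: S_def w_def sum.cartesian_product case_prod_unfold)
  have c1: "(\<Sum>d\<in>D. c d) = 1" and r1: "(\<Sum>d\<in>D. r d) = 1"
    using wK[OF im(1), of "\<lambda>_. 1"] wK[OF im(2), of "\<lambda>_. 1"] w1 by (simp_all add: c_def r_def)
  have "(\<Sum>d\<in>D. (r d)\<^sup>2) = (\<Sum>d\<in>D. (c d)\<^sup>2)"
    unfolding r_def c_def sum_fibre_square[OF fin im(1)] sum_fibre_square[OF fin im(2)]
    unfolding S_def gc_def gr_def w_def
    by (rule autoconv_autocorr_energy[unfolded case_prod_unfold, symmetric])
  also have "\<dots> \<le> (\<Sum>d\<in>D. h * c d)"
    unfolding power2_eq_square by (intro sum_mono mult_right_mono ch c0)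
  finally have r2: "(\<Sum>d\<in>D. (r d)\<^sup>2) \<le> h"
    by (simp add: sum_distrib_left[symmetric] c1)
  have V: "(X - (\<Sum>d\<in>D. K d) / real (2 * N))\<^sup>2 \<le>
      (h - 1 / real (2 * N)) * ((\<Sum>d\<in>D. (K d)\<^sup>2) - (\<Sum>d\<in>D. K d)\<^sup>2 / real (2 * N))"
  proof -
    have DD: "D \<noteq> {}" using N by (simp add: D_def)
    \<comment> \<open>Replacing the energy of \<open>r\<close> by its bound \<open>h\<close>
      requires the factor that belongs to \<open>K\<close> to be nonnegative.\<close>
    have "0 \<le> (\<Sum>d\<in>D. (K d)\<^sup>2) - (\<Sum>d\<in>D. K d)\<^sup>2 / real (2 * N)"
      using sum_squared_le_sum_of_squares[of K D] N
      by (simp add: cardD field_simps)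
    then show ?thesis
      using Cauchy_Schwarz_centered[OF fin(2) DD, of r K] r2 unfolding cardD r1 X_def
      by (smt (verit) mult_right_mono mult_1 power_one)
  qed
  have even: "K (- d) = K d" for d
    unfolding K_def by (rule step_corr_minus[OF k supp])
  \<comment> \<open>Adjointness with \<open>\<phi> = F\<close> turns the square norm of
    \<open>F\<close> into the quadratic form of \<open>K\<close> in \<open>q\<close>.\<close>
  have "(\<Sum>y\<in>Y. (F y)\<^sup>2) = (\<Sum>i<N. q i * step_corr k b \<eta> F (int i))"
    using sum_mult_conv_step[where \<eta> = \<eta> and b = b, OF k supp, where \<phi> = F and q = q and a = a]
    by (simp add: Y_def F_def N_def power2_eq_square)
  also have "\<dots> = (\<Sum>i<N. \<Sum>j<N. q i * q j * K (int i - int j))"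
  proof -
    have "step_corr k b \<eta> F i = (\<Sum>j<N. q j * K (i - int j))" for i
      unfolding step_corr_def F_def K_def sum_distrib_left
      by (subst sum.swap) (simp add: algebra_simps)
    then show ?thesis by (simp add: sum_distrib_left mult.assoc)
  qed
  also have "\<dots> = 2 * (\<Sum>x\<in>S. w x * K (gr x)) + 2 * (\<Sum>x\<in>S. w x * K (gc x))"
    unfolding q_def sum_add_sum_rev_product[where K = K, OF even]
    by (simp add: S_def w_def gr_def gc_def sum.cartesian_product case_prod_unfold)
  also have "\<dots> = 2 * X + 2 * (\<Sum>d\<in>D. c d * K d)"
    unfolding X_def c_def r_def wK[OF im(1)] wK[OF im(2)] ..
  also have "(\<Sum>d\<in>D. c d * K d) \<le> h * (\<Sum>d\<in>D. K d)"
    unfolding sum_distrib_left by (intro sum_mono mult_right_mono ch K0)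
  finally have F2: "(\<Sum>y\<in>Y. (F y)\<^sup>2) \<le> 2 * X + 2 * (h * (\<Sum>d\<in>D. K d))"
    by simp
  have q1: "(\<Sum>i<N. q i) = 2"
    using f1 by (simp add: q_def sum.distrib sum.nat_diff_reindex)
  \<comment> \<open>\<open>q\<close> has mass 2, and each correlation is \<open>k\<close> times a
    convex combination of the block correlations at \<open>i div k\<close> and
    \<open>i div k + 1\<close>. The last block reaches lag \<open>a\<close>, which is why
    \<open>\<gamma>\<close> must bound that lag too.\<close>
  have \<psi>F: "(\<Sum>y\<in>Y. \<psi> (y div int k) * F y) \<ge> 2 * real k * \<gamma>"
  proof -
    have "real k * \<gamma> \<le> step_corr k b \<eta> (\<lambda>z. \<psi> (z div int k)) (int i)" if "i < N" for i
    proof -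
      have lt: "i div k < a"
        using that k by (simp add: N_def div_less_iff_less_mult)
      have i: "int i = int (i div k) * int k + int (i mod k)"
        by (metis div_mult_mod_eq of_nat_add of_nat_mult)
      have m: "int (i mod k) < int k" using k by simp
      have "real k * \<gamma> = of_int (int k - int (i mod k)) * \<gamma> + of_int (int (i mod k)) * \<gamma>"
        by (simp add: algebra_simps)
      also have "\<dots> \<le> of_int (int k - int (i mod k)) * corr b \<eta> \<psi> (int (i div k)) +
          of_int (int (i mod k)) * corr b \<eta> \<psi> (int (i div k) + 1)"
        using lt m by (intro add_mono mult_left_mono \<gamma>) auto
      also have "\<dots> = step_corr k b \<eta> (\<lambda>z. \<psi> (z div int k)) (int i)"
        by (subst i, rule step_corr_step[symmetric]) (use m in auto)
      finally show ?thesis .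
    qed
    then have "(\<Sum>i<N. q i * (real k * \<gamma>)) \<le>
      (\<Sum>i<N. q i * step_corr k b \<eta> (\<lambda>z. \<psi> (z div int k)) (int i))"
      using f by (intro sum_mono mult_left_mono) (auto simp: q_def)
    then show ?thesis
      using sum_mult_conv_step[where \<eta> = \<eta> and b = b, OF k supp, where \<phi> = "\<lambda>y. \<psi> (y div int k)" and q = q and a = a]
      by (simp add: Y_def F_def N_def[symmetric] sum_distrib_right[symmetric] q1 mult.assoc)
  qed
  have \<psi>2: "(\<Sum>y\<in>Y. (\<psi> (y div int k))\<^sup>2) = real k * P"
    using sum_int_blocks[OF k, of "\<lambda>y. (\<psi> (y div int k))\<^sup>2" 0 "int (a + b)"] k
    by (simp add: Y_def P_def sum_distrib_left)
  have "0 \<le> (\<Sum>y\<in>Y. (F y - s * \<psi> (y div int k))\<^sup>2)"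
    by (intro sum_nonneg) simp
  also have "\<dots> = (\<Sum>y\<in>Y. (F y)\<^sup>2) - 2 * s * (\<Sum>y\<in>Y. \<psi> (y div int k) * F y) + s\<^sup>2 * (\<Sum>y\<in>Y. (\<psi> (y div int k))\<^sup>2)"
    by (simp add: power2_diff power_mult_distrib sum.distrib sum_subtractf sum_distrib_left algebra_simps)
  also have "\<dots> \<le> (\<Sum>y\<in>Y. (F y)\<^sup>2) - 2 * s * (2 * real k * \<gamma>) + s\<^sup>2 * (real k * P)"
    using mult_left_mono[OF \<psi>F s] by (simp add: \<psi>2 algebra_simps)
  finally have "2 * s * \<gamma> * real k - s\<^sup>2 * real k * P / 2 \<le> h * (\<Sum>d\<in>D. K d) + X"
    using F2 by (simp add: algebra_simps)
  then show thesis
    using V that unfolding P_def by blast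
qed

section \<open>The chosen step functions and the numerical bound\<close>

text \<open>
  The values of \<open>eta\<close> imitate the arcsine density, which nearly minimises the square norm of the
  autocorrelation. The values of \<open>psi\<close> are a rounded numerical maximiser of the ratio between the
  squared minimum of \<open>corr 8 eta psi\<close> on \<open>{0..29}\<close> and the sum of squares of \<open>psi\<close>.
\<close>

definition eta :: "int \<Rightarrow> real" where
  "eta l = (if l = 0 \<or> l = 7 then 3 else if 0 < l \<and> l < 7 then 1 else 0)"

definition psi :: "int \<Rightarrow> real" where
  "psi j = [58, 65, 63, 61, 62, 66, 73, 101, 82, 78, 74, 69, 64, 60, 60, 72, 78, 81, 82, 81, 78, 72,
    60, 60, 64, 69, 74, 78, 82, 101, 73, 66, 62, 61, 63, 65, 58] ! nat j"

lemma int_atLeastLessThan_rec: "a < b \<Longrightarrow> {a..<b :: int} = insert a {a + 1..<b}"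
  by auto

lemma corr_eta:
  "corr 8 eta \<phi> j = 3 * \<phi> j + \<phi> (1 + j) + \<phi> (2 + j) + \<phi> (3 + j) + \<phi> (4 + j) + \<phi> (5 + j)
    + \<phi> (6 + j) + 3 * \<phi> (7 + j)"
  by (simp add: corr_def eta_def int_atLeastLessThan_rec)

lemma psi_sum_squares: "(\<Sum>j\<in>{0..<int (29 + 8)}. (psi j)\<^sup>2) = 189082"
  by (simp add: psi_def int_atLeastLessThan_rec)

text \<open>A finite check of 30 lags; 867 is attained at lag 0.\<close>

lemma corr_eta_psi: "j \<in> {0..int 29} \<Longrightarrow> 867 \<le> corr 8 eta psi j"
proof -
  have "\<forall>j\<in>{0..<30}. 867 \<le> corr 8 eta psi j"
    by (simp add: int_atLeastLessThan_rec) (simp add: corr_eta psi_def)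
  then show "j \<in> {0..int 29} \<Longrightarrow> 867 \<le> corr 8 eta psi j" by simp
qed

lemma corr_eta_eta_0:
  assumes "j \<notin> {-8<..<8}"
  shows "corr 8 eta eta j = 0"
proof -
  have "eta (l + j) = 0" if "l \<in> {0..<int 8}" for l
    using that assms by (auto simp: eta_def)
  then show ?thesis by (simp add: corr_def)
qed

text \<open>The autocorrelation of \<open>eta\<close> at the lags 0 to 8 is 24, 11, 10, 9, 8, 7, 6,
  9, 0. The pairs of neighbouring values are the end values of the interpolation on each
  block.\<close>

lemma sum_corr_eta:
  fixes g :: "real \<Rightarrow> real \<Rightarrow> real"
  assumes "g 0 0 = 0"
  shows "(\<Sum>j\<in>{-29..<29}. g (corr 8 eta eta j) (corr 8 eta eta (j + 1))) =
    g 0 9 + g 9 6 + g 6 7 + g 7 8 + g 8 9 + g 9 10 + g 10 11 + g 11 24 +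
    g 24 11 + g 11 10 + g 10 9 + g 9 8 + g 8 7 + g 7 6 + g 6 9 + g 9 0"
proof -
  have "(\<Sum>j\<in>{-29..<29}. g (corr 8 eta eta j) (corr 8 eta eta (j + 1))) =
    (\<Sum>j\<in>{-8..<8}. g (corr 8 eta eta j) (corr 8 eta eta (j + 1)))"
  proof (rule sum.mono_neutral_right)
    show "\<forall>j\<in>{-29..<29} - {-8..<8}. g (corr 8 eta eta j) (corr 8 eta eta (j + 1)) = 0"
      using assms by (auto simp: corr_eta_eta_0)
  qed auto
  also have "\<dots> = g 0 9 + g 9 6 + g 6 7 + g 7 8 + g 8 9 + g 9 10 + g 10 11 + g 11 24 +
    g 24 11 + g 11 10 + g 10 9 + g 9 8 + g 8 7 + g 7 6 + g 6 9 + g 9 0"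
    by (simp add: int_atLeastLessThan_rec) (simp add: corr_eta eta_def)
  finally show ?thesis .
qed

text \<open>144 is the square of the total 12 of \<open>eta\<close>. The terms of even lower order
  telescope away: \<open>k\<close> in the first sum and the square of \<open>k\<close> in the
  second.\<close>

lemma sum_step_corr_eta:
  assumes "k > 0"
  defines "K \<equiv> step_corr k 8 eta (\<lambda>z. eta (z div int k))"
  shows "(\<Sum>d\<in>{- int (29 * k)..<int (29 * k)}. K d) = 144 * (real k)\<^sup>2"
    and "(\<Sum>d\<in>{- int (29 * k)..<int (29 * k)}. (K d)\<^sup>2) = 1552 * real k ^ 3 + 88 * real k"
proof -
  have D: "{- int (29 * k)..<int (29 * k)} = {- 29 * int k..<29 * int k}" by simp
  have K: "(\<Sum>v\<in>{0..<int k}. g (K (j * int k + v))) =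
      (\<Sum>v\<in>{0..<int k}. g (of_int (int k - v) * corr 8 eta eta j + of_int v * corr 8 eta eta (j + 1)))"
    for g :: "real \<Rightarrow> real" and j
    unfolding K_def by (intro sum.cong arg_cong[where f = g] step_corr_step) auto
  show "(\<Sum>d\<in>{- int (29 * k)..<int (29 * k)}. K d) = 144 * (real k)\<^sup>2"
    unfolding D sum_int_blocks[OF assms(1)] K[of "\<lambda>x. x"] sum_interpolation
    by (subst sum_corr_eta[of "\<lambda>x y. (real k)\<^sup>2 * ((x + y) / 2) + real k * ((x - y) / 2)"]) simp_all
  show "(\<Sum>d\<in>{- int (29 * k)..<int (29 * k)}. (K d)\<^sup>2) = 1552 * real k ^ 3 + 88 * real k"
    unfolding D sum_int_blocks[OF assms(1)] K[of "\<lambda>x. x\<^sup>2"] sum_interpolation_squares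
    by (subst sum_corr_eta[of "\<lambda>x y. real k ^ 3 * ((x\<^sup>2 + x * y + y\<^sup>2) / 3) + (real k)\<^sup>2 * ((x\<^sup>2 - y\<^sup>2) / 2)
          + real k * ((x - y)\<^sup>2 / 6)"]) simp_all
qed

lemma autoconv_bound:
  fixes f :: "nat \<Rightarrow> real" and k :: nat
  defines "N \<equiv> 29 * k"
  assumes k: "k \<ge> 10" and f: "\<And>i. f i \<ge> 0" and f1: "(\<Sum>i<N. f i) = 1"
    and h: "\<And>e. (\<Sum>(i, j)\<in>{x\<in>{..<N} \<times> {..<N}. int (fst x) + int (snd x) - (int N - 1) = e}. f i * f j) \<le> h"
  shows "2 * real N * h > 1.262"
proof (rule ccontr)
  define m where "m = 2 * real N * h"
  \<comment> \<open>\<open>V\<close> is the sum of squared deviations of \<open>K\<close> from its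
    mean over the \<open>58 * k\<close> points of the range.\<close>
  define V where "V = 1552 * real k ^ 3 + 88 * real k - (144 * (real k)\<^sup>2)\<^sup>2 / (58 * real k)"
  assume "\<not> 2 * real N * h > 1.262"
  then have m: "m \<le> 1.262" by (simp add: m_def)
  have k0: "k > 0" and k1: "real k \<ge> 10" using k by simp_all
  have hm: "h = m / (58 * real k)" using k0 by (simp add: m_def N_def)
  \<comment> \<open>The weight \<open>s = 2 * 867 / 189082\<close> maximises
    \<open>2 * s * 867 - s^2 * 189082 / 2\<close>.\<close>
  obtain X where X:
    "2 * (1734 / 189082) * 867 * real k - (1734 / 189082)\<^sup>2 * real k * 189082 / 2 \<le> h * (144 * (real k)\<^sup>2) + X"
    "(X - 144 * (real k)\<^sup>2 / real (2 * (29 * k)))\<^sup>2 \<le> (h - 1 / real (2 * (29 * k))) *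
      (1552 * real k ^ 3 + 88 * real k - (144 * (real k)\<^sup>2)\<^sup>2 / real (2 * (29 * k)))"
  proof (rule autoconv_ineq[where a = 29 and b = 8 and k = k and \<eta> = eta and \<psi> = psi
        and \<gamma> = 867 and s = "1734 / 189082" and f = f and h = h])
    show "(\<Sum>i<29 * k. f i) = 1" using f1 by (simp add: N_def)
    show "\<And>l. l \<notin> {0..<int 8} \<Longrightarrow> eta l = 0" "\<And>l. eta l \<ge> 0" by (auto simp: eta_def)
    show "\<And>j. j \<in> {0..int 29} \<Longrightarrow> 867 \<le> corr 8 eta psi j" by (rule corr_eta_psi)
    show "f i \<ge> 0" for i by (rule f)
    show "(\<Sum>(i, j)\<in>{x\<in>{..<29 * k} \<times> {..<29 * k}. int (fst x) + int (snd x) - (int (29 * k) - 1) = e}. f i * f j) \<le> h" for e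
      using h[of e] by (simp only: N_def)
    show "k > 0" by (rule k0)
    show "(29 :: nat) > 0" "(1734 / 189082 :: real) \<ge> 0" by simp_all
  qed (rule that; simp only: sum_step_corr_eta[OF k0] psi_sum_squares)
  \<comment> \<open>2.334 is \<open>751689 / 94541 - 144 / 58 * (1.262 + 1)\<close> rounded down;
    the summand 1 comes from the mean.\<close>
  have 1: "X - 144 * (real k)\<^sup>2 / (58 * real k) \<ge> 1167 / 500 * real k"
  proof -
    have c: "h * (144 * (real k)\<^sup>2) = 144 / 58 * (m * real k)"
      "144 * (real k)\<^sup>2 / (58 * real k) = 144 / 58 * real k"
      using k0 by (simp_all add: hm power2_eq_square)
    have g: "2 * (1734 / 189082) * 867 * real k - (1734 / 189082)\<^sup>2 * real k * 189082 / 2 =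
        751689 / 94541 * real k"
      by (simp add: power2_eq_square)
    have "m * real k \<le> 631 / 500 * real k" using m by (intro mult_right_mono) auto
    moreover have "751689 / 94541 * real k \<le> 144 / 58 * (m * real k) + X"
      using X(1) by (simp only: c g)
    ultimately show ?thesis
      unfolding c using k1 by linarith
  qed
  have "(1167 / 500 * real k)\<^sup>2 \<le> (X - 144 * (real k)\<^sup>2 / (58 * real k))\<^sup>2"
    using 1 k1 by (intro power_mono) auto
  also have "\<dots> \<le> (m - 1) / (58 * real k) * V"
    using X(2) k0 by (simp add: V_def hm diff_divide_distrib)
  also have "\<dots> \<le> 0.262 / (58 * real k) * V"
  proof (intro mult_right_mono divide_right_mono)
    have "V = (real k) ^ 3 * (1552 - 20736 / 58) + 88 * real k"
      using k0 by (simp add: V_def field_simps power2_eq_square power3_eq_cube)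
    then show "V \<ge> 0" using k1 by simp
  qed (use m in auto)
  also have "\<dots> = 0.262 / 58 * ((real k)\<^sup>2 * (1552 - 20736 / 58) + 88)"
    using k0 by (simp add: V_def field_simps power2_eq_square power3_eq_cube)
  \<comment> \<open>The square of 2.334 exceeds 5.447, and the term from 88 is below 1. The gap
    0.051 between the leading coefficients beats 1 for \<open>k\<close> at least 10.\<close>
  finally have "5.447 * (real k)\<^sup>2 \<le> 5.396 * (real k)\<^sup>2 + 1"
    by (simp add: power_mult_distrib power_divide)
  moreover have "100 \<le> (real k)\<^sup>2"
    using power_mono[OF k1, of 2] by simp
  ultimately show False by simp
qed

section \<open>Refinement of the polynomial and the final estimate\<close>

lemma diff_mult_div:
  fixes n u r :: nat
  assumes "r > 0"
  shows "(n - u * r) div r = n div r - u"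
proof (induction u)
  case (Suc u)
  have "(m - r) div r = m div r - 1" for m
    using assms by (cases "m < r") (auto simp: le_div_geq)
  from this[of "n - u * r"] show ?case using Suc by (simp add: add.commute)
qed simp

text \<open>Sort the indices \<open>i = u * r + v\<close> of an antidiagonal by their residue
  \<open>v\<close>. For fixed \<open>v\<close> the partner \<open>E - i\<close> has quotient
  \<open>M v - u\<close>, so the inner sum is a coefficient of \<open>p ^ 2\<close>, and there are
  at most \<open>r\<close> residues.\<close>

lemma refined_conv_le:
  fixes p :: "real poly"
  assumes r: "r > 0" and nonneg: "\<And>i. coeff p i \<ge> 0" and H: "\<And>i. coeff (p ^ 2) i \<le> H" "H \<ge> 0"
    and "finite S" and S: "\<And>x. x \<in> S \<Longrightarrow> int (fst x) + int (snd x) = e"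
  shows "(\<Sum>(i, j)\<in>S. coeff p (i div r) * coeff p (j div r)) \<le> real r * H"
proof (cases "S = {}")
  case True
  then show ?thesis using H by simp
next
  case False
  then obtain x where "x \<in> S" by blast
  then obtain E where E: "e = int E"
    using S by (metis of_nat_add)
  define M where "M v = (E - v) div r" for v
  have "S \<subseteq> (\<lambda>i. (i, E - i)) ` {..E}"
  proof
    fix x assume "x \<in> S"
    then have "fst x + snd x = E" using S[of x] E by linarith
    then show "x \<in> (\<lambda>i. (i, E - i)) ` {..E}"
      by (intro image_eqI[of _ _ "fst x"]) (auto simp: prod_eq_iff)
  qed
  then have "(\<Sum>(i, j)\<in>S. coeff p (i div r) * coeff p (j div r)) \<le>
    (\<Sum>(i, j)\<in>(\<lambda>i. (i, E - i)) ` {..E}. coeff p (i div r) * coeff p (j div r))"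
    using nonneg by (intro sum_mono2) auto
  also have "\<dots> = (\<Sum>i\<le>E. coeff p (i div r) * coeff p ((E - i) div r))"
    by (subst sum.reindex) (auto simp: inj_on_def)
  also have "\<dots> = (\<Sum>(v, u)\<in>(SIGMA v:{v. v < r \<and> v \<le> E}. {..M v}). coeff p u * coeff p (M v - u))"
  proof (rule sum.reindex_bij_witness[where i = "\<lambda>(v, u). u * r + v" and j = "\<lambda>i. (i mod r, i div r)"])
    fix i assume i: "i \<in> {..E}"
    have "i div r \<le> M (i mod r)"
      using i r unfolding M_def
      by (metis atMost_iff diff_le_mono div_le_mono minus_mod_eq_mult_div nonzero_mult_div_cancel_left less_not_refl2)
    then show "(i mod r, i div r) \<in> (SIGMA v:{v. v < r \<and> v \<le> E}. {..M v})"
      using i r by (auto intro: order_trans[OF mod_less_eq_dividend])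
    have "E - i = (E - i mod r) - i div r * r"
      by (metis diff_diff_left mod_div_mult_eq)
    then have "(E - i) div r = M (i mod r) - i div r"
      unfolding M_def using r by (simp only: diff_mult_div)
    then show "(case (i mod r, i div r) of (v, u) \<Rightarrow> coeff p u * coeff p (M v - u)) =
        coeff p (i div r) * coeff p ((E - i) div r)"
      by simp
  next
    fix x assume "x \<in> (SIGMA v:{v. v < r \<and> v \<le> E}. {..M v})"
    then show "(case x of (v, u) \<Rightarrow> u * r + v) \<in> {..E}"
      using r by (auto simp: M_def less_eq_div_iff_mult_less_eq)
  qed (use r in auto)
  also have "\<dots> = (\<Sum>v\<in>{v. v < r \<and> v \<le> E}. coeff (p ^ 2) (M v))"
    by (subst sum.Sigma[symmetric]) (auto simp: power2_eq_square coeff_mult)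
  also have "\<dots> \<le> (\<Sum>v\<in>{v. v < r \<and> v \<le> E}. H)"
    by (intro sum_mono H)
  \<comment> \<open>For small \<open>E\<close> some residues do not occur; \<open>H \<ge> 0\<close>
    pays for them.\<close>
  also have "\<dots> \<le> (\<Sum>v<r. H)"
    using H by (intro sum_mono2) auto
  finally show ?thesis by simp
qed

text \<open>Beyond the degree the coefficient is 0, and the height is nonnegative because of
  coefficient 0.\<close>

lemma coeff_le_height: "coeff q i \<le> height q"
proof (cases "i \<le> degree q")
  case True
  then have "\<bar>coeff q i\<bar> \<le> height q" unfolding height_def by (intro Max_ge) auto
  then show ?thesis by simp
next
  case False
  have "\<bar>coeff q 0\<bar> \<le> height q" unfolding height_def by (intro Max_ge) auto
  then show ?thesis using False by (simp add: coeff_eq_0)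
qed

theorem corollary1p5:
  fixes p :: "real poly"
  assumes "p \<noteq> 0"
    and "\<And>i. coeff p i \<ge> 0"
  shows "R_ratio p > 0.631"
proof -
  define d where "d = Suc (degree p)"
  define r where "r = (290::nat)" \<comment> \<open>so that \<open>r * d = 29 * k\<close> with \<open>k = 10 * d\<close>\<close>
  define f where "f i = coeff p (i div r) / (real r * poly p 1)" for i
  define h where "h = height (p ^ 2) / (real r * (poly p 1)\<^sup>2)"
  have p1: "poly p 1 = (\<Sum>i<d. coeff p i)"
    by (simp add: poly_altdef d_def lessThan_Suc_atMost)
  have "0 < coeff p (degree p)"
    using assms by (metis leading_coeff_0_iff order_le_less)
  also have "\<dots> \<le> poly p 1"
    unfolding p1 using assms(2) by (intro member_le_sum) (auto simp: d_def)
  finally have pos: "poly p 1 > 0" .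
  have H: "coeff (p ^ 2) i \<le> height (p ^ 2)" for i by (rule coeff_le_height)
  have "0 \<le> coeff (p ^ 2) 0"
    using assms(2)[of 0] by (simp add: power2_eq_square coeff_mult)
  then have H0: "height (p ^ 2) \<ge> 0" using H[of 0] by simp
  \<comment> \<open>Since \<open>29 * (10 * d) = r * d\<close>, the left side is
    \<open>2 * R_ratio p\<close>, and 1.262 is twice 0.631.\<close>
  have "2 * real (29 * (10 * d)) * h > 1.262"
  proof (rule autoconv_bound[where f = f])
    show "10 \<le> 10 * d" by (simp add: d_def)
    show "f i \<ge> 0" for i using assms(2) pos by (simp add: f_def)
    have "(\<Sum>i<29 * (10 * d). coeff p (i div r)) = (\<Sum>(u, v)\<in>{..<d} \<times> {..<r}. coeff p u)"
      by (rule sum.reindex_bij_witness[where i = "\<lambda>(u, v). u * r + v" and j = "\<lambda>i. (i div r, i mod r)"])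
         (auto simp: r_def)
    also have "\<dots> = real r * poly p 1"
      by (simp add: sum.cartesian_product[symmetric] p1 sum_distrib_left)
    finally show "(\<Sum>i<29 * (10 * d). f i) = 1"
      using pos by (simp add: f_def sum_divide_distrib[symmetric] r_def)
    fix e
    let ?S = "{x \<in> {..<29 * (10 * d)} \<times> {..<29 * (10 * d)}. int (fst x) + int (snd x) - (int (29 * (10 * d)) - 1) = e}"
    have "(\<Sum>(i, j)\<in>?S. f i * f j) =
      (\<Sum>(i, j)\<in>?S. coeff p (i div r) * coeff p (j div r)) / (real r * poly p 1)\<^sup>2"
      by (simp add: f_def sum_divide_distrib power2_eq_square case_prod_unfold)
    also have "\<dots> \<le> real r * height (p ^ 2) / (real r * poly p 1)\<^sup>2"
      \<comment> \<open>The shifted value of \<open>e\<close> undoes the centring of the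
        autoconvolution.\<close>
      by (intro divide_right_mono refined_conv_le[where e = "e + int (29 * (10 * d)) - 1"])
        (use H H0 assms(2) in \<open>auto simp: r_def\<close>)
    also have "\<dots> = h"
      using pos by (simp add: h_def r_def power2_eq_square)
    finally show "(\<Sum>(i, j)\<in>?S. f i * f j) \<le> h" .
  qed
  then show ?thesis
    using pos by (simp add: R_ratio_def h_def d_def r_def field_simps)
qed

end
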